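(* (Embedding equations) Let $\tilde\omega_k$ be the unnormalised nonlinear weights of a WENO scheme that has $r$ substencils $S_0,\dots,S_{r-1}$ and satisfies $\frac{\tilde\omega_k}{\tilde\omega_l}\to\frac{\gamma_k}{\gamma_l}$ as $\Delta x\to0$ whenever $S_k$ and $S_l$ are smooth. Let the unnormalised embedded WENO weights be given by $$\tilde\omega_k^{(\mathrm E)}=\tilde\omega_k\,g_k,\qquad g_k=a_{kk}+\sum_{l\ne k}\frac{a_{kl}\,\beta_l}{\beta_k+\varepsilon},\qquad k=0,1,2,\dots,r-1,$$ where $g_k$ is the correction factor with coefficients $a_{kl}$. Let $K$ be the set of indices such that $\beta_n=\mathcal O(1)$ for $n\in K$, i.e. $S_n$ is not smooth, and let $\beta_k\downarrow0$ for $k\notin K$ as $\Delta x\to0$. Then the embedding equations are given by $$\frac{\gamma_k}{\alpha_k^{(K)}}\sum_{m\in K}a_{km}=\frac{\gamma_l}{\alpha_l^{(K)}}\sum_{n\in K}a_{ln},$$ with $k,l\notin K$ and $n,m\in K$. Here $\alpha_k^{(K)}$ are the desired inner weights and $\gamma_k$ the linear weights.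
   Context: A WENO scheme on a grid of size $\Delta x$ interpolates a function $u$ at a cell interface by combining the lower-order interpolations on $r$ substencils $S_0,\dots,S_{r-1}$ of a larger stencil, using nonlinear weights $\omega_k=\tilde\omega_k/\sum_l\tilde\omega_l$ obtained by normalising the unnormalised nonlinear weights $\tilde\omega_k$. The linear (optimal) weights $\gamma_k$ are the constants whose linear combination of the substencil interpolations gives the high-order approximation on the full stencil. The smoothness indicator $\beta_k$ of $S_k$ measures how rapidly the interpolation on $S_k$ varies; for the five-point scheme ($r=3$) it is the Jiang–Shu indicator $\beta_k=\int_{x_{j-1/2}}^{x_{j+1/2}}\left[(q_k''(x))^2\Delta x^3+(q_k'(x))^2\Delta x\right]dx$, where $q_k$ is the polynomial on $S_k$ with the same cell averages as $u$. A substencil is called smooth when the solution is smooth on it; when it contains a discontinuity its indicator is large, written $\beta_n=\mathcal O(1)$, in contrast to $\mathcal O(\Delta x^2)$ on a smooth substencil. Smooth substencils are taken to be without critical points, so that $\beta_l/\beta_k=1+\mathcal O(\Delta x^s)$ with $s\ge2$ for $S_k,S_l$ smooth. The constant $\varepsilon$ is a small constant that avoids division by zero, assumed so small that it may be ignored in the analysis. The $a_{kl}$ are undetermined coefficients. The inner weights $\alpha_k^{(K)}$, $k\notin K$, are chosen by the user: they are the weights the embedded scheme should produce on the smooth substencils when the substencils $S_n$, $n\in K$, are not smooth. The embedding equations are the equations for the coefficients $a_{kl}$ obtained by requiring that, as $\Delta x\downarrow0$, the ratio $\omega_k^{(\mathrm E)}/\omega_l^{(\mathrm E)}=\tilde\omega_k^{(\mathrm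 E)}/\tilde\omega_l^{(\mathrm E)}$ of embedded weights on smooth substencils equals the ratio $\alpha_k^{(K)}/\alpha_l^{(K)}$ of inner weights.
   Formalization: The indicators of non-smooth substencils are assumed asymptotically equal (β_m/β_n→1 for m,n∈K), and the equations are shown sufficient for the ratio requirement only if the sums of a_km over m∈K are nonzero for k∉K; the claim fails otherwise. ε is taken as o(β_k) for smooth S_k. *)

theory Defs
  imports
    "HOL-Analysis.Analysis"
    "HOL-Computational_Algebra.Polynomial"
    "HOL-Library.Landau_Symbols"
begin

text \<open>
  Coordinates are relative to the centre of the target cell \<open>x\<^sub>j\<close>: cell \<open>i\<close> is the cell
  \<open>x\<^sub>j\<^sub>+\<^sub>i\<close> of a uniform grid of size \<open>h\<close>, and the interface at which the scheme interpolates
  is \<open>x\<^sub>j + h/2\<close>.  A stencil is a set of integer offsets from \<open>j\<close>.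
\<close>

definition cell_avg :: "real \<Rightarrow> (real \<Rightarrow> real) \<Rightarrow> int \<Rightarrow> real" where
  "cell_avg h f i =
     integral {(real_of_int i - 1/2) * h .. (real_of_int i + 1/2) * h} f / h"

text \<open>For \<open>h > 0\<close> and finite nonempty \<open>S\<close> the polynomial below exists and is unique.\<close>

definition stencil_poly :: "real \<Rightarrow> int set \<Rightarrow> (int \<Rightarrow> real) \<Rightarrow> real poly" where
  "stencil_poly h S v =
     (THE q. degree q < card S \<and> (\<forall>i\<in>S. cell_avg h (poly q) i = v i))"

definition interface_value :: "real \<Rightarrow> int set \<Rightarrow> (int \<Rightarrow> real) \<Rightarrow> real" where
  "interface_value h S v = poly (stencil_poly h S v) (h / 2)"

text \<open>
  \<open>J k h q\<close> is the value of the \<open>k\<close>-th smoothness indicator on the polynomial \<open>q\<close>; the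
  Jiang--Shu indicator is the instance \<open>\<integral> (q'')\<^sup>2 h\<^sup>3 + (q')\<^sup>2 h\<close> over cell \<open>0\<close>.
  \<open>W k h v\<close> is the unnormalised nonlinear weight computed from the cell averages \<open>v\<close>.
\<close>

locale weno_scheme =
  fixes r :: nat
    and S :: "nat \<Rightarrow> int set"
    and \<gamma> :: "nat \<Rightarrow> real"
    and J :: "nat \<Rightarrow> real \<Rightarrow> real poly \<Rightarrow> real"
    and W :: "nat \<Rightarrow> real \<Rightarrow> (int \<Rightarrow> real) \<Rightarrow> real"
  assumes substencils_pos: "0 < r"
    and substencil_finite: "k < r \<Longrightarrow> finite (S k)"
    and substencil_nonempty: "k < r \<Longrightarrow> S k \<noteq> {}"
    and linear_weights:
      "0 < h \<Longrightarrow>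
        (\<Sum>k<r. \<gamma> k * interface_value h (S k) v) = interface_value h (\<Union>k<r. S k) v"
    and indicator_nonneg: "k < r \<Longrightarrow> 0 < h \<Longrightarrow> 0 \<le> J k h q"
    and weights_local:
      "k < r \<Longrightarrow> 0 < h \<Longrightarrow> (\<And>i. i \<in> (\<Union>k<r. S k) \<Longrightarrow> v i = v' i) \<Longrightarrow> W k h v = W k h v'"

text \<open>
  The cell averages of \<open>u\<close> on the grid of size \<open>h\<close>.  The centre \<open>x h\<close> may depend on \<open>h\<close>, so
  that a discontinuity of \<open>u\<close> can stay in the same substencil under refinement.
\<close>

definition grid_data :: "(real \<Rightarrow> real) \<Rightarrow> (real \<Rightarrow> real) \<Rightarrow> real \<Rightarrow> int \<Rightarrow> real" where
  "grid_data u x h = cell_avg h (\<lambda>y. u (x h + y))"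

definition smoothness_indicator ::
  "(nat \<Rightarrow> int set) \<Rightarrow> (nat \<Rightarrow> real \<Rightarrow> real poly \<Rightarrow> real) \<Rightarrow> (real \<Rightarrow> real) \<Rightarrow> (real \<Rightarrow> real) \<Rightarrow>
    nat \<Rightarrow> real \<Rightarrow> real" where
  "smoothness_indicator S J u x k h = J k h (stencil_poly h (S k) (grid_data u x h))"

definition correction_factor ::
  "nat \<Rightarrow> (nat \<Rightarrow> nat \<Rightarrow> real) \<Rightarrow> (nat \<Rightarrow> real \<Rightarrow> real) \<Rightarrow> (real \<Rightarrow> real) \<Rightarrow> nat \<Rightarrow> real \<Rightarrow> real" where
  "correction_factor r a \<beta> \<epsilon> k h =
     a k k + (\<Sum>l\<in>{..<r} - {k}. a k l * \<beta> l h / (\<beta> k h + \<epsilon> h))"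

definition normalised :: "nat \<Rightarrow> (nat \<Rightarrow> real \<Rightarrow> real) \<Rightarrow> nat \<Rightarrow> real \<Rightarrow> real" where
  "normalised r w k h = w k h / (\<Sum>l<r. w l h)"

text \<open>
  The requirement that defines the embedding equations: among the indices outside \<open>K\<close>, ratios of
  the normalised weights obtained from \<open>w\<close> tend to the ratios of the inner weights \<open>\<alpha> K\<close>.
\<close>

definition embedding_requirement ::
  "nat \<Rightarrow> nat set \<Rightarrow> (nat set \<Rightarrow> nat \<Rightarrow> real) \<Rightarrow> (nat \<Rightarrow> real \<Rightarrow> real) \<Rightarrow> bool" where
  "embedding_requirement r K \<alpha> w \<longleftrightarrow>
     (\<forall>k\<in>{..<r} - K. \<forall>l\<in>{..<r} - K.
        ((\<lambda>h. normalised r w k h / normalised r w l h) \<longlongrightarrow> \<alpha> K k / \<alpha> K l) (at_right 0))"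

definition embedding_equations ::
  "nat \<Rightarrow> nat set \<Rightarrow> (nat set \<Rightarrow> nat \<Rightarrow> real) \<Rightarrow> (nat \<Rightarrow> real) \<Rightarrow> (nat \<Rightarrow> nat \<Rightarrow> real) \<Rightarrow> bool" where
  "embedding_equations r K \<alpha> \<gamma> a \<longleftrightarrow>
     (\<forall>k\<in>{..<r} - K. \<forall>l\<in>{..<r} - K.
        \<gamma> k / \<alpha> K k * (\<Sum>m\<in>K. a k m) = \<gamma> l / \<alpha> K l * (\<Sum>n\<in>K. a l n))"

end

theory Submission
  imports Defs
begin

text \<open>
  A correction factor \<open>g\<^sub>k\<close> on a smooth substencil in general blows up, because it contains the quotients
  \<open>\<beta>\<^sub>m / (\<beta>\<^sub>k + \<epsilon>)\<close> of an indicator that stays away from zero by one that tends to zero.  The idea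
  is to undo this blow-up by a factor that is, up to \<open>1 + o(1)\<close>, the same for all smooth substencils:
  pick \<open>p \<in> K\<close> and consider \<open>g\<^sub>k \<beta>\<^sub>k / \<beta>\<^sub>p\<close>.  The indicators of the non-smooth substencils are
  asymptotically equal, so each \<open>m \<in> K\<close> contributes \<open>a\<^sub>k\<^sub>m\<close> to the limit; the other terms of \<open>g\<^sub>k\<close> are
  bounded, so the factor \<open>\<beta>\<^sub>k / \<beta>\<^sub>p \<rightarrow> 0\<close> kills them.  Hence \<open>g\<^sub>k \<beta>\<^sub>k / \<beta>\<^sub>p \<rightarrow> A\<^sub>k = \<Sum>\<^sub>m\<^sub>\<in>\<^sub>K a\<^sub>k\<^sub>m\<close>
  (\<open>rescaled_correction_factor_tendsto\<close>).

  Normalisation does not change ratios of weights, and \<open>\<omega>\<^sub>k / \<omega>\<^sub>l \<rightarrow> \<gamma>\<^sub>k / \<gamma>\<^sub>l\<close> and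
  \<open>\<beta>\<^sub>k / \<beta>\<^sub>l \<rightarrow> 1\<close>.  The embedding requirement therefore says that the ratio of two rescaled
  correction factors tends to \<open>c = \<alpha>\<^sub>k \<gamma>\<^sub>l / (\<alpha>\<^sub>l \<gamma>\<^sub>k)\<close>, and the embedding equation says
  \<open>A\<^sub>k = c A\<^sub>l\<close>.  The limit of a ratio with \<open>c \<noteq> 0\<close> always forces this relation between the limits of
  numerator and denominator (\<open>limit_eq_ratio_limit_mult\<close>), even when these vanish; the way back
  divides by \<open>A\<^sub>l\<close>.  If \<open>K\<close> is empty, all the sums \<open>A\<^sub>k\<close> vanish: the equations are trivial, and
  \<open>A\<^sub>k \<noteq> 0\<close> for every smooth substencil is possible only if there is none.
\<close>

lemma tendsto_div_add_negligible:
  fixes f e :: "'a \<Rightarrow> real"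
  assumes small: "e \<in> o[F](f)" and nz: "\<forall>\<^sub>F x in F. f x \<noteq> 0"
  shows "((\<lambda>x. f x / (f x + e x)) \<longlongrightarrow> 1) F"
proof -
  have "((\<lambda>x. e x / f x) \<longlongrightarrow> 0) F"
    using small by (rule smalloD_tendsto)
  then have "((\<lambda>x. inverse (1 + e x / f x)) \<longlongrightarrow> inverse (1 + 0)) F"
    by (intro tendsto_intros) auto
  moreover have "\<forall>\<^sub>F x in F. inverse (1 + e x / f x) = f x / (f x + e x)"
    using nz by eventually_elim (simp add: field_simps)
  ultimately show ?thesis
    by (simp add: tendsto_cong)
qed

lemma tendsto_one_if_minus_one_bigo_power:
  fixes f :: "real \<Rightarrow> real"
  assumes "(\<lambda>h. f h - 1) \<in> O[at_right 0](\<lambda>h. h ^ s)" and "0 < s"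
  shows "(f \<longlongrightarrow> 1) (at_right 0)"
proof -
  have "((\<lambda>h::real. h ^ s) \<longlongrightarrow> 0 ^ s) (at_right 0)"
    by (intro tendsto_intros)
  then have "(\<lambda>h::real. h ^ s) \<in> o[at_right 0](\<lambda>_. 1)"
    using \<open>0 < s\<close> by (intro smalloI_tendsto) auto
  with assms(1) have "(\<lambda>h. f h - 1) \<in> o[at_right 0](\<lambda>_. 1)"
    by (rule landau_o.big_small_trans)
  then have "((\<lambda>h. f h - 1) \<longlongrightarrow> 0) (at_right 0)"
    by (auto dest: smalloD_tendsto)
  then show ?thesis
    by (simp add: LIM_zero_iff)
qed

text \<open>
  Dividing the limits would need \<open>B \<noteq> 0\<close>.  Instead, write \<open>f = (f / g) g\<close>: this holds eventually,
  since \<open>f / g\<close> has a non-zero limit and division by zero yields zero, so that \<open>g\<close> is eventually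
  non-zero.
\<close>

lemma limit_eq_ratio_limit_mult:
  fixes f g :: "'a \<Rightarrow> real"
  assumes "F \<noteq> bot"
    and f: "(f \<longlongrightarrow> A) F" and g: "(g \<longlongrightarrow> B) F"
    and ratio: "((\<lambda>x. f x / g x) \<longlongrightarrow> c) F" and "c \<noteq> 0"
  shows "A = c * B"
proof -
  have "\<forall>\<^sub>F x in F. f x / g x \<noteq> 0"
    using ratio \<open>c \<noteq> 0\<close> by (rule tendsto_imp_eventually_ne)
  then have "\<forall>\<^sub>F x in F. f x / g x * g x = f x"
    by eventually_elim auto
  moreover have "((\<lambda>x. f x / g x * g x) \<longlongrightarrow> c * B) F"
    by (intro tendsto_intros ratio g)
  ultimately have "(f \<longlongrightarrow> c * B) F"
    by (simp add: tendsto_cong)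
  with \<open>F \<noteq> bot\<close> f show ?thesis
    by (rule tendsto_unique)
qed

lemma normalised_ratio:
  assumes "(\<Sum>j<r. w j h) \<noteq> 0"
  shows "normalised r w k h / normalised r w l h = w k h / w l h"
  using assms by (simp add: normalised_def)

text \<open>
  Here \<open>b\<close> is the common size of the indicators on the non-smooth substencils.  After
  multiplication by \<open>\<beta>\<^sub>k / b\<close> the term of \<open>l\<close> becomes \<open>a\<^sub>k\<^sub>l (\<beta>\<^sub>l / b) (\<beta>\<^sub>k / (\<beta>\<^sub>k + \<epsilon>))\<close>, where the
  middle factor \<open>\<beta>\<^sub>l / b\<close> tends to \<open>1\<close> for \<open>l \<in> K\<close> and to \<open>0\<close> for \<open>l \<notin> K\<close>,
  while the last factor tends to \<open>1\<close>.
\<close>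

lemma rescaled_correction_factor_tendsto:
  assumes K: "K \<subseteq> {..<r}" and k: "k < r" "k \<notin> K"
    and nonsmooth: "\<And>m. m \<in> K \<Longrightarrow> ((\<lambda>h. \<beta> m h / b h) \<longlongrightarrow> 1) F"
    and smooth: "\<And>l. l < r \<Longrightarrow> l \<notin> K \<Longrightarrow> ((\<lambda>h. \<beta> l h / b h) \<longlongrightarrow> 0) F"
    and eps: "((\<lambda>h. \<beta> k h / (\<beta> k h + \<epsilon> h)) \<longlongrightarrow> 1) F"
  shows "((\<lambda>h. correction_factor r a \<beta> \<epsilon> k h * (\<beta> k h / b h)) \<longlongrightarrow> (\<Sum>m\<in>K. a k m)) F"
proof -
  have expand: "correction_factor r a \<beta> \<epsilon> k h * (\<beta> k h / b h) =
      a k k * (\<beta> k h / b h) +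
      (\<Sum>l\<in>{..<r} - {k}. a k l * (\<beta> l h / b h) * (\<beta> k h / (\<beta> k h + \<epsilon> h)))" for h
    by (simp add: correction_factor_def ring_distribs sum_distrib_left sum_distrib_right sum_divide_distrib mult_ac)
  have lim: "((\<lambda>h. \<beta> l h / b h) \<longlongrightarrow> (if l \<in> K then 1 else 0)) F" if "l < r" for l
    using nonsmooth smooth that by auto
  have "((\<lambda>h. correction_factor r a \<beta> \<epsilon> k h * (\<beta> k h / b h)) \<longlongrightarrow>
      a k k * 0 + (\<Sum>l\<in>{..<r} - {k}. a k l * (if l \<in> K then 1 else 0) * 1)) F"
    unfolding expand by (intro tendsto_intros smooth k eps lim) auto
  also have "(\<Sum>l\<in>{..<r} - {k}. a k l * (if l \<in> K then 1 else 0) * 1) = (\<Sum>m\<in>K. a k m)"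
    using K k by (intro sum.mono_neutral_cong_right) auto
  finally show ?thesis
    by simp
qed

theorem theorem1:
  fixes r s :: nat
    and S :: "nat \<Rightarrow> int set"
    and \<gamma> :: "nat \<Rightarrow> real"
    and J :: "nat \<Rightarrow> real \<Rightarrow> real poly \<Rightarrow> real"
    and W :: "nat \<Rightarrow> real \<Rightarrow> (int \<Rightarrow> real) \<Rightarrow> real"
    and u x \<epsilon> :: "real \<Rightarrow> real"
    and \<beta> \<omega> \<omega>E :: "nat \<Rightarrow> real \<Rightarrow> real"
    and a :: "nat \<Rightarrow> nat \<Rightarrow> real"
    and \<alpha> :: "nat set \<Rightarrow> nat \<Rightarrow> real"
    and K :: "nat set"
  assumes scheme: "weno_scheme r S \<gamma> J W"
    and \<beta>_eq: "\<beta> = smoothness_indicator S J u x"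
    and \<omega>_eq: "\<omega> = (\<lambda>k h. W k h (grid_data u x h))"
    and \<omega>E_eq: "\<omega>E = (\<lambda>k h. \<omega> k h * correction_factor r a \<beta> \<epsilon> k h)"
    and K_eq: "K = {n. n < r \<and> \<beta> n \<in> \<Theta>[at_right 0](\<lambda>h. 1)}"
    and K_comparable:
      "\<And>m n. m \<in> K \<Longrightarrow> n \<in> K \<Longrightarrow> ((\<lambda>h. \<beta> m h / \<beta> n h) \<longlongrightarrow> 1) (at_right 0)"
    and smooth_decay:
      "\<And>k. k < r \<Longrightarrow> k \<notin> K \<Longrightarrow> filterlim (\<beta> k) (at_right 0) (at_right 0)"
    and s_ge: "s \<ge> 2"
    and smooth_ratio:
      "\<And>k l. k < r \<Longrightarrow> l < r \<Longrightarrow> k \<notin> K \<Longrightarrow> l \<notin> K \<Longrightarrow>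
        (\<lambda>h. \<beta> l h / \<beta> k h - 1) \<in> O[at_right 0](\<lambda>h. h ^ s)"
    and \<epsilon>_negligible: "\<And>k. k < r \<Longrightarrow> k \<notin> K \<Longrightarrow> \<epsilon> \<in> o[at_right 0](\<beta> k)"
    and weights_limit:
      "\<And>k l. k < r \<Longrightarrow> l < r \<Longrightarrow> k \<notin> K \<Longrightarrow> l \<notin> K \<Longrightarrow>
        ((\<lambda>h. \<omega> k h / \<omega> l h) \<longlongrightarrow> \<gamma> k / \<gamma> l) (at_right 0)"
    and \<gamma>_nz: "\<And>k. k < r \<Longrightarrow> k \<notin> K \<Longrightarrow> \<gamma> k \<noteq> 0"
    and \<alpha>_nz: "\<And>k. k < r \<Longrightarrow> k \<notin> K \<Longrightarrow> \<alpha> K k \<noteq> 0"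
    and normalisable: "\<forall>\<^sub>F h in at_right 0. (\<Sum>l<r. \<omega>E l h) \<noteq> 0"
  shows "(embedding_requirement r K \<alpha> \<omega>E \<longrightarrow> embedding_equations r K \<alpha> \<gamma> a) \<and>
         ((\<forall>k\<in>{..<r} - K. (\<Sum>m\<in>K. a k m) \<noteq> 0) \<longrightarrow>
           (embedding_requirement r K \<alpha> \<omega>E \<longleftrightarrow> embedding_equations r K \<alpha> \<gamma> a))"
proof -
  have K: "K \<subseteq> {..<r}"
    using K_eq by auto
  define A where "A k = (\<Sum>m\<in>K. a k m)" for k
  have \<beta>_nz: "\<forall>\<^sub>F h in at_right 0. \<beta> k h \<noteq> 0" if "k < r" "k \<notin> K" for k
    using smooth_decay[OF that] by (auto simp: filterlim_at elim: eventually_mono)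
  have \<beta>_ratio: "((\<lambda>h. \<beta> l h / \<beta> k h) \<longlongrightarrow> 1) (at_right 0)"
    if "k < r" "l < r" "k \<notin> K" "l \<notin> K" for k l
    using smooth_ratio[OF that] s_ge by (intro tendsto_one_if_minus_one_bigo_power) auto
  have requirement_iff: "embedding_requirement r K \<alpha> \<omega>E \<longleftrightarrow>
      (\<forall>k\<in>{..<r} - K. \<forall>l\<in>{..<r} - K.
        ((\<lambda>h. \<omega>E k h / \<omega>E l h) \<longlongrightarrow> \<alpha> K k / \<alpha> K l) (at_right 0))"
  proof -
    have "((\<lambda>h. normalised r \<omega>E k h / normalised r \<omega>E l h) \<longlongrightarrow> c) (at_right 0) \<longleftrightarrow>
        ((\<lambda>h. \<omega>E k h / \<omega>E l h) \<longlongrightarrow> c) (at_right 0)" for k l c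
      using normalisable
      by (intro tendsto_cong) (auto elim!: eventually_mono simp: normalised_ratio)
    then show ?thesis
      unfolding embedding_requirement_def by simp
  qed
  have equation_iff: "\<gamma> k / \<alpha> K k * A k = \<gamma> l / \<alpha> K l * A l \<longleftrightarrow>
      A k = \<alpha> K k / \<alpha> K l / (\<gamma> k / \<gamma> l) * A l"
    if "k < r" "l < r" "k \<notin> K" "l \<notin> K" for k l
    using that \<gamma>_nz \<alpha>_nz by (simp add: field_simps)
  show ?thesis
  proof (cases "K = {}")
    case True
    then show ?thesis
      by (auto simp: embedding_equations_def embedding_requirement_def)
  next
    case False
    then obtain p where p: "p \<in> K"
      by blast
    then have \<beta>p: "\<beta> p \<in> \<Theta>[at_right 0](\<lambda>_. 1)"
      using K_eq by auto
    have \<beta>p_nz: "\<forall>\<^sub>F h in at_right 0. \<beta> p h \<noteq> 0"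
      using eventually_nonzero_bigtheta[OF \<beta>p] by simp
    have vanish: "((\<lambda>h. \<beta> k h / \<beta> p h) \<longlongrightarrow> 0) (at_right 0)" if "k < r" "k \<notin> K" for k
    proof -
      have "\<beta> k \<in> o[at_right 0](\<lambda>_. 1)"
        using smooth_decay[OF that] by (intro smalloI_tendsto) (auto simp: filterlim_at)
      with \<beta>p have "\<beta> k \<in> o[at_right 0](\<beta> p)"
        by (metis landau_o.small.cong_bigtheta)
      then show ?thesis
        by (rule smalloD_tendsto)
    qed
    define G where "G k h = correction_factor r a \<beta> \<epsilon> k h * (\<beta> k h / \<beta> p h)" for k h
    have G: "(G k \<longlongrightarrow> A k) (at_right 0)" if "k < r" "k \<notin> K" for k
      unfolding G_def A_def
      by (intro rescaled_correction_factor_tendsto tendsto_div_add_negligible K K_comparable p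
            vanish \<epsilon>_negligible \<beta>_nz that)
    \<comment> \<open>The common scale \<open>\<beta>\<^sub>p\<close> cancels; only the ratio of the smooth indicators is left over.\<close>
    have \<omega>E_ratio: "\<forall>\<^sub>F h in at_right 0.
        \<omega>E k h / \<omega>E l h = \<omega> k h / \<omega> l h * (G k h / G l h) * (\<beta> l h / \<beta> k h)"
      if "k < r" "l < r" "k \<notin> K" "l \<notin> K" for k l
      using \<beta>_nz[OF that(1,3)] \<beta>_nz[OF that(2,4)] \<beta>p_nz
      by eventually_elim (simp add: \<omega>E_eq G_def)
    have necessary: "A k = \<alpha> K k / \<alpha> K l / (\<gamma> k / \<gamma> l) * A l"
      if kl: "k < r" "l < r" "k \<notin> K" "l \<notin> K"
        and lim: "((\<lambda>h. \<omega>E k h / \<omega>E l h) \<longlongrightarrow> \<alpha> K k / \<alpha> K l) (at_right 0)" for k l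
    proof -
      have \<gamma>kl: "\<gamma> k / \<gamma> l \<noteq> 0" and \<alpha>kl: "\<alpha> K k / \<alpha> K l \<noteq> 0"
        using \<gamma>_nz \<alpha>_nz kl by auto
      have \<omega>_lim: "((\<lambda>h. \<omega> k h / \<omega> l h) \<longlongrightarrow> \<gamma> k / \<gamma> l) (at_right 0)"
        by (rule weights_limit[OF kl])
      have "((\<lambda>h. \<omega>E k h / \<omega>E l h / (\<omega> k h / \<omega> l h) * (\<beta> k h / \<beta> l h)) \<longlongrightarrow>
          \<alpha> K k / \<alpha> K l / (\<gamma> k / \<gamma> l) * 1) (at_right 0)"
        by (intro tendsto_intros lim \<omega>_lim \<gamma>kl \<beta>_ratio kl)
      moreover have "\<forall>\<^sub>F h in at_right 0.
          \<omega>E k h / \<omega>E l h / (\<omega> k h / \<omega> l h) * (\<beta> k h / \<beta> l h) = G k h / G l h"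
        using \<omega>E_ratio[OF kl] tendsto_imp_eventually_ne[OF \<omega>_lim \<gamma>kl]
          \<beta>_nz[OF kl(1,3)] \<beta>_nz[OF kl(2,4)]
      proof eventually_elim
        case (elim h)
        from elim(2-4) show ?case
          unfolding elim(1) by simp
      qed
      ultimately have "((\<lambda>h. G k h / G l h) \<longlongrightarrow> \<alpha> K k / \<alpha> K l / (\<gamma> k / \<gamma> l)) (at_right 0)"
        by (simp add: tendsto_cong)
      then show ?thesis
        using \<gamma>kl \<alpha>kl
        by (intro limit_eq_ratio_limit_mult[OF _ G G] kl) auto
    qed
    have sufficient: "((\<lambda>h. \<omega>E k h / \<omega>E l h) \<longlongrightarrow> \<alpha> K k / \<alpha> K l) (at_right 0)"
      if kl: "k < r" "l < r" "k \<notin> K" "l \<notin> K" and "A l \<noteq> 0"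
        and eq: "A k = \<alpha> K k / \<alpha> K l / (\<gamma> k / \<gamma> l) * A l" for k l
    proof -
      have "((\<lambda>h. \<omega> k h / \<omega> l h * (G k h / G l h) * (\<beta> l h / \<beta> k h)) \<longlongrightarrow>
          \<gamma> k / \<gamma> l * (A k / A l) * 1) (at_right 0)"
        by (intro tendsto_intros weights_limit G \<beta>_ratio kl \<open>A l \<noteq> 0\<close>)
      moreover have "\<gamma> k / \<gamma> l * (A k / A l) * 1 = \<alpha> K k / \<alpha> K l"
        using \<gamma>_nz kl \<open>A l \<noteq> 0\<close> by (simp add: eq)
      ultimately show ?thesis
        using \<omega>E_ratio[OF kl] by (simp add: tendsto_cong)
    qed
    have requirement_imp_equations: "embedding_equations r K \<alpha> \<gamma> a"
      if req: "embedding_requirement r K \<alpha> \<omega>E"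
      unfolding embedding_equations_def A_def[symmetric]
    proof (intro ballI)
      fix k l
      assume mem: "k \<in> {..<r} - K" "l \<in> {..<r} - K"
      then have kl: "k < r" "l < r" "k \<notin> K" "l \<notin> K"
        by auto
      have "((\<lambda>h. \<omega>E k h / \<omega>E l h) \<longlongrightarrow> \<alpha> K k / \<alpha> K l) (at_right 0)"
        using req mem unfolding requirement_iff by blast
      then show "\<gamma> k / \<alpha> K k * A k = \<gamma> l / \<alpha> K l * A l"
        unfolding equation_iff[OF kl] by (rule necessary[OF kl])
    qed
    have equations_imp_requirement: "embedding_requirement r K \<alpha> \<omega>E"
      if nz: "\<forall>k\<in>{..<r} - K. (\<Sum>m\<in>K. a k m) \<noteq> 0"
        and eqs: "embedding_equations r K \<alpha> \<gamma> a"
      unfolding requirement_iff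
    proof (intro ballI)
      fix k l
      assume kl: "k \<in> {..<r} - K" "l \<in> {..<r} - K"
      then have "\<gamma> k / \<alpha> K k * A k = \<gamma> l / \<alpha> K l * A l" "A l \<noteq> 0"
        using nz eqs unfolding embedding_equations_def A_def by blast+
      with kl show "((\<lambda>h. \<omega>E k h / \<omega>E l h) \<longlongrightarrow> \<alpha> K k / \<alpha> K l) (at_right 0)"
        using equation_iff[of k l] by (intro sufficient) simp_all
    qed
    show ?thesis
      using requirement_imp_equations equations_imp_requirement by blast
  qed
qed

end
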